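(* Let $\mathcal{H}_A,\mathcal{H}_B$ be finite-dimensional complex Hilbert spaces, fix an orthonormal basis $\{|j\rangle\}$ of $\mathcal{H}_A$, let $\rho_A$ be a density operator on $\mathcal{H}_A$, let $\mathcal{E}_{B|A}:\mathfrak{L}(\mathcal{H}_A)\to\mathfrak{L}(\mathcal{H}_B)$ be a trace-preserving completely positive map, and let $\tau_{AB}$ be the bipartite state isomorphic to the pair $(\rho_A,\mathcal{E}_{B|A})$ (see context). Let $M=\{M^{(m)}\}_m$ and $N=\{N^{(n)}\}_n$ be arbitrary POVMs on $\mathcal{H}_A$ and $\mathcal{H}_B$ respectively, and let $M^T=\{(M^{(m)})^T\}_m$. Then the joint probability distribution of $M$- and $N$-measurements performed in parallel on $\tau_{AB}$ is the same as the joint probability distribution of the sequence consisting of an $M^T$-preparation of $\rho_A$, followed by evolution according to $\mathcal{E}_{B|A}$, followed by an $N$-measurement. That is, for all $m,n$, $$\mathrm{Tr}\left[(M^{(m)}\otimes N^{(n)})\,\tau_{AB}\right]=\mathrm{Tr}\left[N^{(n)}\,\mathcal{E}_{B|A}\left(\rho_A^{1/2}(M^{(m)})^T\rho_A^{1/2}\right)\right].$$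
   Context: $\mathfrak{L}(\mathcal{H})$ is the space of linear operators on $\mathcal{H}$. $^T$ denotes transpose with respect to the fixed basis $\{|j\rangle\}$ of $\mathcal{H}_A$. A POVM on $\mathcal{H}$ is a family of positive semidefinite operators on $\mathcal{H}$, indexed by a set of positive integers, that sums to the identity. Isomorphic state: let $A'$ be a copy of $A$ with $\mathcal{H}_{A'}=\mathcal{H}_A$, let $d_A=\dim\mathcal{H}_A$, $|\Phi^+\rangle_{AA'}=\frac{1}{\sqrt{d_A}}\sum_j|j\rangle_A\otimes|j\rangle_{A'}$, and $|\Phi\rangle_{AA'}=\sqrt{d_A}\,((\rho_A^T)^{1/2}\otimes I_{A'})|\Phi^+\rangle_{AA'}$. The state isomorphic to $(\rho_A,\mathcal{E}_{B|A})$ is $\tau_{AB}=(\mathcal{I}_A\otimes\mathcal{E}_{B|A'})(|\Phi\rangle\langle\Phi|_{AA'})$, where $\mathcal{I}_A$ is the identity map on $\mathfrak{L}(\mathcal{H}_A)$ and $\mathcal{E}_{B|A'}$ is $\mathcal{E}_{B|A}$ applied to $A'$. (It depends only on the restriction of $\mathcal{E}_{B|A}$ to operators supported on the support of $\rho_A$.) An $L$-measurement of a state $\rho$, for a POVM $L=\{L^{(l)}\}$, yields outcome $l$ with probability $\mathrm{Tr}(L^{(l)}\rho)$. An $L$-preparation of $\rho$ consists in generating a classical random variable $l$ with distribution $P(l)=\mathrm{Tr}(L^{(l)}\rho)$ and then preparing the density operator $\sqrt{\rho}\,L^{(l)}\sqrt{\rho}/P(l)$. Thus, in the sequential experiment,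 the joint probability of preparing $m$ and then measuring $n$ is the right-hand side of the displayed identity. *)

theory Defs
  imports "HOL-Analysis.Analysis"
begin

(* A finite-dimensional Hilbert space with a fixed orthonormal basis indexed by 'a is
   complex^'a, the fixed basis vectors being axis j 1; operators are matrices in that
   basis, so the transpose with respect to the basis is the library's transpose.
   H_A \<otimes> H_B is complex^('a \<times> 'b). *)

type_synonym 'a operator = "complex^'a^'a"

definition cinner :: "complex^'a \<Rightarrow> complex^'a \<Rightarrow> complex" where
  "cinner u v = (\<Sum>i\<in>UNIV. cnj (u $ i) * v $ i)"

definition cscale :: "complex \<Rightarrow> complex^'a^'b \<Rightarrow> complex^'a^'b" where
  "cscale c A = map_matrix ((*) c) A"

(* Over the complex numbers this condition already forces A to be Hermitian. *)
definition psd :: "('a::finite) operator \<Rightarrow> bool" where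
  "psd A \<longleftrightarrow> (\<forall>v. cinner v (A *v v) \<in> \<real>\<^sub>\<ge>\<^sub>0)"

definition density_operator :: "('a::finite) operator \<Rightarrow> bool" where
  "density_operator \<rho> \<longleftrightarrow> psd \<rho> \<and> trace \<rho> = 1"

(* Meaningful for positive semidefinite A only. *)
definition psd_sqrt :: "('a::finite) operator \<Rightarrow> 'a operator" where
  "psd_sqrt A = (THE R. psd R \<and> R ** R = A)"

(* The index set may be infinite; the sum is then in the (norm) topology of the matrices. *)
definition povm :: "nat set \<Rightarrow> (nat \<Rightarrow> ('a::finite) operator) \<Rightarrow> bool" where
  "povm I L \<longleftrightarrow> I \<subseteq> {0<..} \<and> (\<forall>l\<in>I. psd (L l)) \<and> (L has_sum mat 1) I"

definition kron_vec :: "complex^'a \<Rightarrow> complex^'b \<Rightarrow> complex^('a \<times> 'b)" where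
  "kron_vec u v = (\<chi> p. u $ fst p * v $ snd p)"

definition kron :: "('a::finite) operator \<Rightarrow> ('b::finite) operator \<Rightarrow> ('a \<times> 'b) operator" where
  "kron A B = (\<chi> p q. A $ fst p $ fst q * B $ snd p $ snd q)"

(* The operator |v><v|. *)
definition ketbra :: "complex^'a \<Rightarrow> ('a::finite) operator" where
  "ketbra v = (\<chi> i j. v $ i * cnj (v $ j))"

(* For an operator on C^k \<otimes> H given by its blocks X i j (i, j < k), this is positive
   semidefiniteness, the vectors of C^k \<otimes> H being the families v 0, ..., v (k - 1). *)
definition block_psd :: "nat \<Rightarrow> (nat \<Rightarrow> nat \<Rightarrow> ('a::finite) operator) \<Rightarrow> bool" where
  "block_psd k X \<longleftrightarrow>
     (\<forall>v. (\<Sum>i<k. \<Sum>j<k. cinner (v i) (X i j *v v j)) \<in> \<real>\<^sub>\<ge>\<^sub>0)"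

(* The identity map on L(C^k) tensored with E is positive for every k. Blocks over nat are
   used since the ancilla dimension is quantified inside the definition. *)
definition completely_positive :: "(('a::finite) operator \<Rightarrow> ('b::finite) operator) \<Rightarrow> bool" where
  "completely_positive E \<longleftrightarrow>
     Vector_Spaces.linear cscale cscale E \<and>
     (\<forall>k X. block_psd k X \<longrightarrow> block_psd k (\<lambda>i j. E (X i j)))"

definition trace_preserving :: "(('a::finite) operator \<Rightarrow> ('b::finite) operator) \<Rightarrow> bool" where
  "trace_preserving E \<longleftrightarrow> (\<forall>X. trace (E X) = trace X)"

(* The tensor product of the identity map on L(H_C) with a linear map E, applied blockwise;
   cf. id_tensor_kron below. *)
definition id_tensor ::
  "(('a::finite) operator \<Rightarrow> ('b::finite) operator) \<Rightarrow>
   (('c::finite) \<times> 'a) operator \<Rightarrow> ('c \<times> 'b) operator" where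
  "id_tensor E X =
     (\<chi> p q. E (\<chi> i j. X $ (fst p, i) $ (fst q, j)) $ snd p $ snd q)"

definition max_entangled :: "complex^(('a::finite) \<times> 'a)" where
  "max_entangled =
     complex_of_real (1 / sqrt (real CARD('a))) *s
       (\<Sum>j\<in>UNIV. kron_vec (axis j 1) (axis j 1))"

definition iso_vector :: "('a::finite) operator \<Rightarrow> complex^('a \<times> 'a)" where
  "iso_vector \<rho> =
     complex_of_real (sqrt (real CARD('a))) *s
       (kron (psd_sqrt (transpose \<rho>)) (mat 1) *v max_entangled)"

definition isomorphic_state ::
  "('a::finite) operator \<Rightarrow> ('a operator \<Rightarrow> ('b::finite) operator) \<Rightarrow> ('a \<times> 'b) operator" where
  "isomorphic_state \<rho> E = id_tensor E (ketbra (iso_vector \<rho>))"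

definition measurement_prob :: "('a::finite) operator \<Rightarrow> 'a operator \<Rightarrow> complex" where
  "measurement_prob L \<rho> = trace (L ** \<rho>)"

(* The state prepared on outcome l of a preparation; the junk value 0 if P(l) = 0. *)
definition prepared_state :: "('a::finite) operator \<Rightarrow> 'a operator \<Rightarrow> 'a operator" where
  "prepared_state L \<rho> =
     cscale (1 / measurement_prob L \<rho>) (psd_sqrt \<rho> ** L ** psd_sqrt \<rho>)"

definition parallel_prob ::
  "('a::finite) operator \<Rightarrow> ('b::finite) operator \<Rightarrow> ('a \<times> 'b) operator \<Rightarrow> complex" where
  "parallel_prob M N \<tau> = measurement_prob (kron M N) \<tau>"

definition sequential_prob ::
  "('a::finite) operator \<Rightarrow> ('b::finite) operator \<Rightarrow> 'a operator \<Rightarrow>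
   ('a operator \<Rightarrow> 'b operator) \<Rightarrow> complex" where
  "sequential_prob L N \<rho> E =
     measurement_prob L \<rho> * measurement_prob N (E (prepared_state L \<rho>))"

lemma vector_space_cscale:
  "vector_space (cscale :: complex \<Rightarrow> complex^'a^'b \<Rightarrow> complex^'a^'b)"
  by unfold_locales (simp_all add: cscale_def vec_eq_iff algebra_simps)

lemma id_tensor_kron:
  assumes "Vector_Spaces.linear cscale cscale E"
  shows "id_tensor E (kron X Y) = kron X (E Y)"
proof -
  interpret Vector_Spaces.linear cscale cscale E by (rule assms)
  have "(\<chi> i j. kron X Y $ (a, i) $ (b, j)) = cscale (X $ a $ b) Y" for a b
    by (simp add: kron_def cscale_def vec_eq_iff)
  then show ?thesis
    by (simp add: id_tensor_def scale) (simp add: kron_def cscale_def vec_eq_iff)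
qed

end

theory Submission
  imports Defs
begin

text \<open>In the fixed basis the components of \<open>iso_vector \<rho>\<close> are the entries of the transposed
  square root of \<open>\<rho>\<close>, so block \<open>(a', a)\<close> of the isomorphic state is the image under \<open>E\<close> of
  \<open>S |a'><a| S\<close> with \<open>S = psd_sqrt \<rho>\<close>; weighting these blocks with the entries of \<open>M\<close> and using
  linearity of \<open>E\<close> gives the trace identity. An outcome of probability zero needs a separate
  argument: \<open>S L S\<close> is then positive semidefinite with trace zero, hence zero.

  What remains is that positive semidefinite matrices have a unique positive semidefinite square
  root. The space \<open>complex^'a\<close> is regarded as a real Euclidean space, where the spectral theorem
  for self-adjoint maps gives a unique square root; uniqueness of its action on eigenvectors makes
  it commute with multiplication by \<open>\<i>\<close>.\<close>

section \<open>Square roots of positive self-adjoint maps on Euclidean spaces\<close>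

text \<open>\<open>x\<close> minimises the nonnegative form on \<open>S\<close>. Along the direction
  \<open>f x\<close> its first-order change is \<open>2 * t\<close> times the squared norm of
  \<open>f x\<close>, so \<open>f x \<noteq> 0\<close> would make it negative for a small negative
  \<open>t\<close>.\<close>

lemma self_adjoint_kernel:
  fixes f :: "'a::real_inner \<Rightarrow> 'a"
  assumes "linear f" and sa: "\<And>x y. f x \<bullet> y = x \<bullet> f y"
    and S: "subspace S" "\<And>x. x \<in> S \<Longrightarrow> f x \<in> S"
    and nonneg: "\<And>x. x \<in> S \<Longrightarrow> 0 \<le> x \<bullet> f x"
    and x: "x \<in> S" "x \<bullet> f x = 0"
  shows "f x = 0"
proof (rule ccontr)
  assume "f x \<noteq> 0"
  interpret linear f by fact
  define y where "y = f x"
  define a where "a = y \<bullet> y"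
  define b where "b = y \<bullet> f y"
  \<comment> \<open>The quadratic \<open>2 * t * a + t * t * b\<close> has its minimum at
    \<open>- a / b\<close>; the denominator \<open>b + 1\<close> keeps it negative and also covers
    \<open>b = 0\<close>.\<close>
  define t where "t = - a / (b + 1)"
  have a: "a > 0" using \<open>f x \<noteq> 0\<close> by (simp add: a_def y_def)
  have y: "y \<in> S" using S x by (simp add: y_def)
  have b: "b \<ge> 0" using nonneg y by (simp add: b_def)
  have "x + t *\<^sub>R y \<in> S" using S x y by (simp add: subspace_add subspace_mul)
  then have "0 \<le> (x + t *\<^sub>R y) \<bullet> f (x + t *\<^sub>R y)" by (rule nonneg)
  also have "\<dots> = x \<bullet> f x + 2 * t * (y \<bullet> f x) + t * t * (y \<bullet> f y)"
    using sa[of x y] by (simp add: add scale inner_add_left inner_add_right inner_commute algebra_simps)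
  also have "\<dots> = 2 * t * a + t * t * b" using x by (simp add: a_def b_def y_def)
  also have "\<dots> = - (a * a * (b + 2)) / ((b + 1) * (b + 1))"
    using b by (simp add: t_def divide_simps) (simp add: algebra_simps)
  also have "\<dots> < 0" using a b by (simp add: divide_neg_pos)
  finally show False by simp
qed

text \<open>Let \<open>c\<close> be the maximum of the quadratic form on the unit sphere of
  \<open>S\<close>. Then \<open>c\<close> times the identity minus \<open>f\<close> is nonnegative
  on \<open>S\<close> and its form vanishes at the maximiser, which therefore lies in its
  kernel.\<close>

lemma self_adjoint_eigenvector_exists:
  fixes f :: "'a::euclidean_space \<Rightarrow> 'a"
  assumes "linear f" and sa: "\<And>x y. f x \<bullet> y = x \<bullet> f y"
    and S: "subspace S" "\<And>x. x \<in> S \<Longrightarrow> f x \<in> S" and "S \<noteq> {0}"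
  obtains v c where "v \<in> S" "norm v = 1" "f v = c *\<^sub>R v"
proof -
  interpret linear f by fact
  let ?K = "S \<inter> sphere 0 1"
  obtain u where "u \<in> S" "u \<noteq> 0" using \<open>S \<noteq> {0}\<close> S(1) subspace_0 by blast
  then have "(1 / norm u) *\<^sub>R u \<in> ?K" using S(1) by (simp add: subspace_mul)
  then have ne: "?K \<noteq> {}" by blast
  have "compact ?K" using closed_subspace[OF S(1)] by (simp add: closed_Int_compact)
  moreover have "continuous_on ?K (\<lambda>x. x \<bullet> f x)"
    by (intro continuous_intros linear_continuous_on linear_conv_bounded_linear[THEN iffD1] assms(1))
  ultimately obtain v where v: "v \<in> ?K" and max: "\<And>y. y \<in> ?K \<Longrightarrow> y \<bullet> f y \<le> v \<bullet> f v"
    using continuous_attains_sup[OF _ ne] by blast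
  define c where "c = v \<bullet> f v"
  have vv: "v \<bullet> v = 1" using v by (simp add: dot_square_norm)
  have bound: "0 \<le> y \<bullet> (c *\<^sub>R y - f y)" if "y \<in> S" for y
  proof (cases "y = 0")
    case False
    let ?z = "(1 / norm y) *\<^sub>R y"
    have "?z \<in> ?K" using that False S(1) by (simp add: subspace_mul)
    from max[OF this] have "(y \<bullet> f y) / (norm y * norm y) \<le> c"
      by (simp add: c_def scale)
    then have "y \<bullet> f y \<le> c * (norm y * norm y)" using False by (simp add: divide_simps)
    then show ?thesis by (simp add: inner_diff_right dot_square_norm power2_eq_square)
  qed (simp)
  have "c *\<^sub>R v - f v = 0"
  proof (rule self_adjoint_kernel[where f = "\<lambda>y. c *\<^sub>R y - f y" and S = S])
    show "linear (\<lambda>y. c *\<^sub>R y - f y)" by (intro linear_compose_sub linear_scale_self assms(1))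
  qed (use S v vv bound sa in \<open>auto simp: inner_diff_left inner_diff_right c_def subspace_diff subspace_mul\<close>)
  then show ?thesis using that[of v c] v by auto
qed

text \<open>Induction on the dimension: split off a unit eigenvector \<open>v\<close>; by
  self-adjointness its orthogonal complement within \<open>S\<close> is again invariant.\<close>

lemma self_adjoint_eigenbasis_subspace:
  fixes f :: "'a::euclidean_space \<Rightarrow> 'a"
  assumes "linear f" and sa: "\<And>x y. f x \<bullet> y = x \<bullet> f y"
    and "subspace S" "\<And>x. x \<in> S \<Longrightarrow> f x \<in> S"
  shows "\<exists>B. finite B \<and> pairwise orthogonal B \<and> (\<forall>b\<in>B. norm b = 1) \<and> span B = S \<and>
    (\<forall>b\<in>B. \<exists>c. f b = c *\<^sub>R b)"
  using assms(3,4)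
proof (induction "dim S" arbitrary: S rule: less_induct)
  case (less S)
  show ?case
  proof (cases "S = {0}")
    case True
    then show ?thesis by (intro exI[of _ "{}"]) auto
  next
    case False
    then obtain v c where v: "v \<in> S" "norm v = 1" "f v = c *\<^sub>R v"
      using self_adjoint_eigenvector_exists[OF assms(1,2) less.prems] by blast
    have vv: "v \<bullet> v = 1" using v by (simp add: dot_square_norm)
    define S' where "S' = {x \<in> S. v \<bullet> x = 0}"
    have S': "subspace S'" using less.prems(1)
      by (auto simp: S'_def subspace_def inner_add_right)
    have inv: "f x \<in> S'" if "x \<in> S'" for x
      using that less.prems(2) v(3) sa[of v x] by (auto simp: S'_def)
    have "v \<notin> S'" "S' \<subseteq> S" using vv by (auto simp: S'_def)
    then have "S' \<subset> S" using v(1) by blast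
    then have "dim S' < dim S" using S' less.prems(1) by (metis dim_psubset span_eq_iff)
    from less.hyps[OF this S' inv] obtain B where B: "finite B" "pairwise orthogonal B"
      "\<forall>b\<in>B. norm b = 1" "span B = S'" "\<forall>b\<in>B. \<exists>c. f b = c *\<^sub>R b" by blast
    have BS: "b \<in> S" "v \<bullet> b = 0" if "b \<in> B" for b
      using that B(4) span_base[of b B] by (auto simp: S'_def)
    have "S \<subseteq> span (insert v B)"
    proof
      fix x assume "x \<in> S"
      then have "x - (v \<bullet> x) *\<^sub>R v \<in> S'"
        using v less.prems(1) vv by (auto simp: S'_def subspace_diff subspace_mul inner_diff_right)
      then show "x \<in> span (insert v B)" using B(4) span_breakdown_eq[of x v B] by blast
    qed
    moreover have "span (insert v B) \<subseteq> S"
      using BS(1) v(1) less.prems(1) by (intro span_minimal) auto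
    ultimately have "span (insert v B) = S" by blast
    moreover have "pairwise orthogonal (insert v B)"
      using B(2) BS(2) by (auto simp: pairwise_insert orthogonal_def inner_commute)
    ultimately show ?thesis using B v by (intro exI[of _ "insert v B"]) auto
  qed
qed

text \<open>Self-adjointness is a separate condition because over the reals a nonnegative quadratic
  form does not imply it.\<close>

definition positive_map :: "('a::real_inner \<Rightarrow> 'a) \<Rightarrow> bool" where
  "positive_map f \<longleftrightarrow> linear f \<and> (\<forall>x y. f x \<bullet> y = x \<bullet> f y) \<and> (\<forall>x. 0 \<le> x \<bullet> f x)"

lemma positive_map_kernel:
  assumes "positive_map f" "x \<bullet> f x = 0"
  shows "f x = 0"
  using assms by (intro self_adjoint_kernel[where f = f and S = UNIV]) (auto simp: positive_map_def)

lemma positive_map_eigenbasis: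
  fixes f :: "'a::euclidean_space \<Rightarrow> 'a"
  assumes "positive_map f"
  obtains B where "finite B" "pairwise orthogonal B" "\<And>b. b \<in> B \<Longrightarrow> b \<bullet> b = 1" "span B = UNIV"
    "\<And>b. b \<in> B \<Longrightarrow> f b = (b \<bullet> f b) *\<^sub>R b"
proof -
  have "\<exists>B. finite B \<and> pairwise orthogonal B \<and> (\<forall>b\<in>B. norm b = 1) \<and> span B = UNIV \<and>
    (\<forall>b\<in>B. \<exists>c. f b = c *\<^sub>R b)"
    using assms by (intro self_adjoint_eigenbasis_subspace) (auto simp: positive_map_def)
  then obtain B where B: "finite B" "pairwise orthogonal B" "\<forall>b\<in>B. norm b = 1" "span B = UNIV"
    and ev: "\<forall>b\<in>B. \<exists>c. f b = c *\<^sub>R b" by blast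
  have unit: "b \<bullet> b = 1" if "b \<in> B" for b using B(3) that by (simp add: dot_square_norm)
  have "f b = (b \<bullet> f b) *\<^sub>R b" if b: "b \<in> B" for b
  proof -
    obtain c where "f b = c *\<^sub>R b" using ev b by blast
    then show ?thesis using unit[OF b] by simp
  qed
  then show ?thesis using that B unit by blast
qed

text \<open>For \<open>c > 0\<close>, \<open>w = R v - sqrt c *\<^sub>R v\<close> satisfies
  \<open>R w = - sqrt c *\<^sub>R w\<close>, which positivity allows only for \<open>w = 0\<close>.
  For \<open>c = 0\<close> the squared norm of \<open>R v\<close> is
  \<open>v \<bullet> R (R v) = 0\<close>.\<close>

lemma positive_map_square_eigenvector:
  assumes R: "positive_map R" and v: "R (R v) = c *\<^sub>R v" and "0 \<le> c"
  shows "R v = sqrt c *\<^sub>R v"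
proof (cases "c = 0")
  case True
  have "R v \<bullet> R v = v \<bullet> R (R v)" using R by (simp add: positive_map_def)
  then show ?thesis using v True by simp
next
  case False
  interpret linear R using R by (simp add: positive_map_def)
  define w where "w = R v - sqrt c *\<^sub>R v"
  have "R w + sqrt c *\<^sub>R w = 0"
    using v \<open>0 \<le> c\<close> by (simp add: w_def diff scale algebra_simps)
  then have "w \<bullet> R w + sqrt c * (w \<bullet> w) = 0"
    by (metis inner_add_right inner_scaleR_right inner_zero_right)
  moreover have "0 \<le> w \<bullet> R w" using R by (simp add: positive_map_def)
  moreover have "0 < sqrt c" using False \<open>0 \<le> c\<close> by simp
  ultimately have "w \<bullet> w = 0"
    by (smt (verit) inner_ge_zero mult_pos_pos)
  then show ?thesis by (simp add: w_def)
qed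

text \<open>An eigenvector of \<open>R\<close> for \<open>c\<close> is one of the common square for
  \<open>c * c\<close>, so \<open>R'\<close> also multiplies it by \<open>c\<close>; such vectors
  span the space.\<close>

lemma positive_map_sqrt_unique:
  fixes R R' :: "'a::euclidean_space \<Rightarrow> 'a"
  assumes R: "positive_map R" and R': "positive_map R'" and eq: "\<And>x. R (R x) = R' (R' x)"
  shows "R = R'"
proof
  fix x
  obtain B where B: "span B = UNIV" "\<And>b. b \<in> B \<Longrightarrow> R b = (b \<bullet> R b) *\<^sub>R b"
    using positive_map_eigenbasis[OF R] by metis
  show "R x = R' x"
  proof (rule linear_eq_on_span[where f = R and g = R' and B = B])
    fix b assume b: "b \<in> B"
    define c where "c = b \<bullet> R b"
    have c: "R b = c *\<^sub>R b" "0 \<le> c" using B(2)[OF b] R by (simp_all add: c_def positive_map_def)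
    have "R (R b) = (c * c) *\<^sub>R b"
      using c(1) R by (simp add: positive_map_def linear_scale)
    then have "R' b = sqrt (c * c) *\<^sub>R b"
      using eq by (intro positive_map_square_eigenvector[OF R', where v = b]) simp_all
    then show "R b = R' b" using c by simp
  qed (use R R' B in \<open>auto simp: positive_map_def\<close>)
qed

text \<open>In an orthonormal eigenbasis, replace each eigenvalue by its square root.\<close>

lemma positive_map_sqrt_exists:
  fixes f :: "'a::euclidean_space \<Rightarrow> 'a"
  assumes f: "positive_map f"
  obtains R where "positive_map R" "\<And>x. R (R x) = f x"
proof -
  obtain B where B: "finite B" "pairwise orthogonal B" "\<And>b. b \<in> B \<Longrightarrow> b \<bullet> b = 1" "span B = UNIV"
    and ev: "\<And>b. b \<in> B \<Longrightarrow> f b = (b \<bullet> f b) *\<^sub>R b"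
    using positive_map_eigenbasis[OF f] by metis
  define s where "s b = sqrt (b \<bullet> f b)" for b
  have nonneg: "0 \<le> b \<bullet> f b" for b using f by (simp add: positive_map_def)
  define R where "R x = (\<Sum>b\<in>B. (s b * (b \<bullet> x)) *\<^sub>R b)" for x
  have linR: "linear R"
    by (rule linearI) (simp_all add: R_def inner_add_right algebra_simps sum.distrib scaleR_sum_right)
  have Rb: "R b = s b *\<^sub>R b" if "b \<in> B" for b
  proof -
    \<comment> \<open>Orthonormality leaves only the summand of \<open>b\<close> itself.\<close>
    have "R b = (\<Sum>b'\<in>B. if b' = b then s b *\<^sub>R b else 0)"
      unfolding R_def using B(2,3) that
      by (intro sum.cong) (auto simp: pairwise_def orthogonal_def)
    then show ?thesis using B(1) that by simp
  qed
  have "R x \<bullet> y = x \<bullet> R y" for x y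
    by (simp add: R_def inner_sum_left inner_sum_right inner_commute mult_ac)
  moreover have "0 \<le> x \<bullet> R x" for x
    unfolding R_def inner_sum_right
    by (intro sum_nonneg) (simp add: s_def nonneg inner_commute mult.assoc)
  ultimately have "positive_map R" using linR by (simp add: positive_map_def)
  moreover have "R (R x) = f x" for x
  proof -
    have "(R \<circ> R) x = f x"
    proof (rule linear_eq_on_span[where f = "R \<circ> R" and g = f and B = B])
      fix b assume b: "b \<in> B"
      have "R (R b) = (s b * s b) *\<^sub>R b" using Rb[OF b] linR by (simp add: linear_scale)
      then show "(R \<circ> R) b = f b" using ev[OF b] nonneg by (simp add: s_def)
    qed (use f B linR in \<open>auto simp: positive_map_def intro: linear_compose\<close>)
    then show ?thesis by simp
  qed
  ultimately show ?thesis using that by blast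
qed

section \<open>Positive semidefinite matrices\<close>

text \<open>This links the real Euclidean structure, where the spectral theorem was proved, to the
  Hermitian form that defines \<open>psd\<close>.\<close>

lemma inner_eq_Re_cinner: "inner u v = Re (cinner u v)" for u v :: "complex^'a"
  by (simp add: inner_vec_def cinner_def inner_complex_def)

lemma cinner_add_left: "cinner (u + v) w = cinner u w + cinner v w"
  and cinner_add_right: "cinner w (u + v) = cinner w u + cinner w v"
  and cinner_scale_left: "cinner (c *s u) w = cnj c * cinner u w"
  and cinner_scale_right: "cinner w (c *s u) = c * cinner w u"
  by (simp_all add: cinner_def algebra_simps sum.distrib sum_distrib_left)

lemma cinner_commute: "cinner u v = cnj (cinner v u)"
  by (simp add: cinner_def mult.commute)

lemma linear_matrix_vector_mult: "linear ((*v) A)" for A :: "complex^'a^'b"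
  by (rule linearI)
    (simp_all add: vec_eq_iff matrix_vector_mult_def algebra_simps sum.distrib scaleR_sum_right)

lemma psd_iff_positive_map: "psd A \<longleftrightarrow> positive_map ((*v) A)" for A :: "('a::finite) operator"
proof
  assume A: "psd A"
  have real: "Im (cinner v (A *v v)) = 0" and nonneg: "0 \<le> Re (cinner v (A *v v))" for v
    using A by (auto simp: psd_def complex_nonneg_Reals_iff)
  \<comment> \<open>Polarisation: the form is real at \<open>u + v\<close>, \<open>u\<close> and
    \<open>v\<close>, so the cross terms have imaginary part zero. Replacing \<open>v\<close> by
    \<open>\<i> *s v\<close> then turns this into symmetry of the real parts.\<close>
  have "Im (cinner u (A *v v)) + Im (cinner v (A *v u)) = 0" for u v
    using real[of "u + v"] real[of u] real[of v]
    by (simp add: matrix_vector_right_distrib cinner_add_left cinner_add_right)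
  from this[of _ "\<i> *s _"]
  have "Re (cinner u (A *v v)) = Re (cinner v (A *v u))" for u v
    by (simp add: matrix_vector_mult_scaleR vector_scalar_commute cinner_scale_left cinner_scale_right)
  then have "(A *v u) \<bullet> v = u \<bullet> (A *v v)" for u v
    by (simp add: inner_eq_Re_cinner cinner_commute[of "A *v u"])
  then show "positive_map ((*v) A)"
    using nonneg by (simp add: positive_map_def linear_matrix_vector_mult inner_eq_Re_cinner)
next
  assume A: "positive_map ((*v) A)"
  show "psd A" unfolding psd_def complex_nonneg_Reals_iff
  proof (intro allI conjI)
    fix v :: "complex^'a"
    show "0 \<le> Re (cinner v (A *v v))"
      using A by (simp add: positive_map_def inner_eq_Re_cinner)
    \<comment> \<open>Self-adjointness for the pair \<open>v\<close>, \<open>\<i> *s v\<close>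
      equates the imaginary part of the form at \<open>v\<close> with its negative.\<close>
    have "(A *v v) \<bullet> (\<i> *s v) = v \<bullet> (A *v (\<i> *s v))" using A by (simp add: positive_map_def)
    then show "Im (cinner v (A *v v)) = 0"
      by (simp add: inner_eq_Re_cinner vector_scalar_commute cinner_scale_right
          cinner_commute[of "A *v v"])
  qed
qed

lemma psd_cinner:
  assumes "psd A"
  shows "cinner (A *v u) v = cinner u (A *v v)"
proof (rule complex_eqI)
  have sa: "(A *v u) \<bullet> v = u \<bullet> (A *v v)" for u v
    using assms by (simp add: psd_iff_positive_map positive_map_def)
  show "Re (cinner (A *v u) v) = Re (cinner u (A *v v))"
    using sa by (simp add: inner_eq_Re_cinner)
  show "Im (cinner (A *v u) v) = Im (cinner u (A *v v))"
    using sa[of u "\<i> *s v"]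
    by (simp add: inner_eq_Re_cinner vector_scalar_commute cinner_scale_right)
qed

lemma cinner_axis_left: "cinner (axis i 1) v = v $ i"
  by (simp add: cinner_def axis_def if_distrib if_distribR cong: if_cong)

lemma matrix_vector_mult_axis: "(A *v axis j 1) $ i = A $ i $ j" for A :: "complex^'a^'b"
  by (simp add: matrix_vector_mult_def axis_def if_distrib if_distribR cong: if_cong)

lemma psd_hermitian:
  assumes "psd A"
  shows "cnj (A $ j $ i) = A $ i $ j"
  using psd_cinner[OF assms, of "axis i 1" "axis j 1"]
  by (simp add: cinner_commute[of "A *v axis i 1"] cinner_axis_left matrix_vector_mult_axis)

text \<open>The form of the transpose at \<open>v\<close> is the form of \<open>A\<close> at the
  entrywise conjugate of \<open>v\<close>.\<close>

lemma psd_transpose: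
  fixes A :: "('a::finite) operator"
  assumes "psd A"
  shows "psd (transpose A)"
  unfolding psd_def
proof
  fix v :: "complex^'a"
  define w where "w = (\<chi> i. cnj (v $ i))"
  have "cinner v (transpose A *v v) = (\<Sum>i\<in>UNIV. \<Sum>j\<in>UNIV. cnj (v $ i) * (A $ j $ i * v $ j))"
    by (simp add: cinner_def matrix_vector_mult_def transpose_def sum_distrib_left)
  also have "\<dots> = (\<Sum>j\<in>UNIV. \<Sum>i\<in>UNIV. cnj (v $ i) * (A $ j $ i * v $ j))"
    by (rule sum.swap)
  also have "\<dots> = cinner w (A *v w)"
    by (simp add: cinner_def matrix_vector_mult_def w_def sum_distrib_left mult_ac)
  finally show "cinner v (transpose A *v v) \<in> \<real>\<^sub>\<ge>\<^sub>0" using assms by (simp add: psd_def)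
qed

lemma psd_conjugate:
  fixes S L :: "('a::finite) operator"
  assumes S: "psd S" and L: "psd L"
  shows "psd (S ** L ** S)"
  unfolding psd_def
proof
  fix v :: "complex^'a"
  have "cinner v ((S ** L ** S) *v v) = cinner (S *v v) (L *v (S *v v))"
    by (simp add: psd_cinner[OF S] matrix_vector_mul_assoc[symmetric])
  then show "cinner v ((S ** L ** S) *v v) \<in> \<real>\<^sub>\<ge>\<^sub>0" using L by (simp add: psd_def)
qed

text \<open>The diagonal entries are nonnegative with sum zero, so the form vanishes at every basis
  vector; each basis vector then lies in the kernel.\<close>

lemma psd_trace_0:
  fixes A :: "('a::finite) operator"
  assumes A: "psd A" and "trace A = 0"
  shows "A = 0"
proof -
  have diag: "cinner (axis i 1) (A *v axis i 1) = A $ i $ i" for i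
    by (simp add: cinner_axis_left matrix_vector_mult_axis)
  have "0 \<le> Re (A $ i $ i)" for i
    using A[unfolded psd_def, rule_format, of "axis i 1"] diag
    by (simp add: complex_nonneg_Reals_iff)
  moreover have "(\<Sum>i\<in>UNIV. Re (A $ i $ i)) = 0"
    using \<open>trace A = 0\<close> by (simp add: trace_def flip: Re_sum)
  ultimately have "Re (A $ i $ i) = 0" for i
    by (simp add: sum_nonneg_eq_0_iff)
  then have "axis i 1 \<bullet> (A *v axis i 1) = 0" for i
    by (simp add: inner_eq_Re_cinner diag)
  then have "A *v axis i 1 = 0" for i
    using A by (intro positive_map_kernel[where f = "(*v) A"]) (simp_all add: psd_iff_positive_map)
  then show ?thesis by (simp add: vec_eq_iff flip: matrix_vector_mult_axis)
qed

text \<open>The Euclidean root \<open>R\<close> is a priori only real-linear. If \<open>b\<close> is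
  an eigenvector of \<open>A\<close>, so is \<open>\<i> *s b\<close> for the same eigenvalue
  \<open>c\<close>, and \<open>R\<close> multiplies both by \<open>sqrt c\<close>; hence
  \<open>R\<close> commutes with \<open>\<i>\<close> and is given by a complex matrix.\<close>

lemma psd_sqrt_exists:
  fixes A :: "('a::finite) operator"
  assumes A: "psd A"
  shows "\<exists>R. psd R \<and> R ** R = A"
proof -
  obtain R where R: "positive_map R" and RR: "\<And>x. R (R x) = A *v x"
    using A positive_map_sqrt_exists[of "(*v) A"] by (auto simp: psd_iff_positive_map)
  obtain B where B: "span B = UNIV"
    and ev: "\<And>b. b \<in> B \<Longrightarrow> A *v b = (b \<bullet> (A *v b)) *\<^sub>R b"
    using A positive_map_eigenbasis[of "(*v) A"] by (metis psd_iff_positive_map)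
  have linR: "linear R" using R by (simp add: positive_map_def)
  have lini: "linear ((*s) \<i> :: complex^'a \<Rightarrow> complex^'a)"
    by (rule linearI) (simp_all add: vec_eq_iff algebra_simps)
  have Ri: "R (\<i> *s x) = \<i> *s R x" for x
  proof -
    have "(R \<circ> (*s) \<i>) x = ((*s) \<i> \<circ> R) x"
    proof (rule linear_eq_on_span[where f = "R \<circ> (*s) \<i>" and g = "(*s) \<i> \<circ> R" and B = B])
      fix b assume b: "b \<in> B"
      define c where "c = b \<bullet> (A *v b)"
      have c: "0 \<le> c" using A by (simp add: c_def psd_iff_positive_map positive_map_def)
      have Ab: "A *v b = c *\<^sub>R b" using ev[OF b] by (simp add: c_def)
      have "R (R (\<i> *s b)) = c *\<^sub>R (\<i> *s b)"
        using Ab lini by (simp add: RR vector_scalar_commute linear_scale)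
      then have "R (\<i> *s b) = sqrt c *\<^sub>R (\<i> *s b)"
        using c by (rule positive_map_square_eigenvector[OF R])
      moreover have "R b = sqrt c *\<^sub>R b"
        using c Ab by (intro positive_map_square_eigenvector[OF R, where v = b]) (simp_all add: RR)
      ultimately show "(R \<circ> (*s) \<i>) b = ((*s) \<i> \<circ> R) b"
        using lini by (simp add: linear_scale)
    qed (use B linR lini in \<open>auto intro: linear_compose\<close>)
    then show ?thesis by simp
  qed
  have decomp: "z *s x = Re z *\<^sub>R x + Im z *\<^sub>R (\<i> *s x)" for z and x :: "complex^'a"
    by (simp add: vec_eq_iff complex_eq_iff)
  have "R (z *s x) = z *s R x" for z x
    unfolding decomp[of z x] decomp[of z "R x"]
    by (simp only: linear_add[OF linR] linear_scale[OF linR] Ri)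
  then have "Vector_Spaces.linear (*s) (*s) R"
    by (simp add: Vector_Spaces.linear_iff vec.vector_space_axioms linear_add[OF linR])
  then have mat: "matrix R *v x = R x" for x by (rule matrix_works)
  then have "(*v) (matrix R) = R" by (simp add: fun_eq_iff)
  then have "psd (matrix R)" using R by (simp add: psd_iff_positive_map)
  moreover have "matrix R ** matrix R = A"
    by (simp add: matrix_eq matrix_vector_mul_assoc[symmetric] mat RR)
  ultimately show ?thesis by blast
qed

lemma psd_sqrt_unique:
  assumes "psd R" "psd R'" "R ** R = R' ** R'"
  shows "R = R'"
proof -
  have "(*v) R = (*v) R'"
    using assms by (intro positive_map_sqrt_unique[where R = "(*v) R" and R' = "(*v) R'"])
      (simp_all add: psd_iff_positive_map matrix_vector_mul_assoc)
  then show ?thesis by (metis matrix_eq)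
qed

lemma psd_sqrt_eqI:
  assumes "psd R" "R ** R = A"
  shows "psd_sqrt A = R"
  unfolding psd_sqrt_def using assms psd_sqrt_unique by blast

lemma psd_psd_sqrt: "psd A \<Longrightarrow> psd (psd_sqrt A)"
  and psd_sqrt_square: "psd A \<Longrightarrow> psd_sqrt A ** psd_sqrt A = A"
  using psd_sqrt_exists psd_sqrt_eqI by blast+

lemma psd_sqrt_transpose:
  assumes "psd A"
  shows "psd_sqrt (transpose A) = transpose (psd_sqrt A)"
  by (rule psd_sqrt_eqI)
    (simp_all add: assms psd_transpose psd_psd_sqrt psd_sqrt_square flip: matrix_transpose_mul)

section \<open>Parallel and sequential experiments\<close>

lemma sum_UNIV_prod:
  "(\<Sum>p\<in>UNIV. g p) = (\<Sum>a\<in>UNIV. \<Sum>b\<in>UNIV. g (a, b))"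
  for g :: "'a::finite \<times> 'b::finite \<Rightarrow> 'c::comm_monoid_add"
  by (simp add: sum.cartesian_product case_prod_beta flip: UNIV_Times_UNIV)

lemma max_entangled_nth:
  "(max_entangled :: complex^(('a::finite) \<times> 'a)) $ (a, b) =
    (if a = b then complex_of_real (1 / sqrt (real CARD('a))) else 0)"
proof -
  have "(\<Sum>j\<in>UNIV. kron_vec (axis j 1) (axis j 1) $ (a, b)) =
      (\<Sum>j\<in>UNIV. if j = a then (if a = b then 1 else 0) else (0 :: complex))"
    by (intro sum.cong) (auto simp: kron_vec_def axis_def)
  then show ?thesis by (simp add: max_entangled_def)
qed

text \<open>The dimension factors cancel, and applying a matrix to the first half of the
  unnormalised maximally entangled vector lists the entries of that matrix.\<close>

lemma iso_vector_nth: "iso_vector \<rho> $ (a, b) = psd_sqrt (transpose \<rho>) $ a $ b"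
  for \<rho> :: "('a::finite) operator"
proof -
  let ?T = "psd_sqrt (transpose \<rho>)" and ?k = "complex_of_real (1 / sqrt (real CARD('a)))"
  have "(kron ?T (mat 1) *v max_entangled) $ (a, b) =
      (\<Sum>i\<in>UNIV. \<Sum>j\<in>UNIV. (?T $ a $ i * mat 1 $ b $ j) * max_entangled $ (i, j))"
    by (simp add: matrix_vector_mult_def kron_def sum_UNIV_prod)
  \<comment> \<open>The identity factor forces \<open>j = b\<close>, the entangled vector
    \<open>i = j\<close>.\<close>
  also have "\<dots> = (\<Sum>i\<in>UNIV. \<Sum>j\<in>UNIV. if j = b then if i = b then ?T $ a $ b * ?k else 0 else 0)"
    by (intro sum.cong) (auto simp: max_entangled_nth mat_def)
  also have "\<dots> = ?T $ a $ b * ?k"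
    by simp
  finally show ?thesis by (simp add: iso_vector_def)
qed

text \<open>The transpose in \<open>iso_vector\<close> swaps the indices of the root; the conjugate
  from the bra is absorbed because the root is Hermitian.\<close>

lemma isomorphic_state_nth:
  assumes "psd \<rho>"
  shows "isomorphic_state \<rho> E $ (a', b') $ (a, b) =
    E (\<chi> i j. psd_sqrt \<rho> $ i $ a' * psd_sqrt \<rho> $ a $ j) $ b' $ b"
proof -
  have "iso_vector \<rho> $ (a, b) = psd_sqrt \<rho> $ b $ a" for a b
    by (simp only: iso_vector_nth psd_sqrt_transpose[OF assms]) (simp add: transpose_def)
  then show ?thesis
    by (simp add: isomorphic_state_def id_tensor_def ketbra_def psd_hermitian psd_psd_sqrt assms)
qed

lemma trace_kron_isomorphic_state:
  assumes \<rho>: "psd \<rho>" and E: "Vector_Spaces.linear cscale cscale E"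
  shows "trace (kron M N ** isomorphic_state \<rho> E) =
    trace (N ** E (psd_sqrt \<rho> ** transpose M ** psd_sqrt \<rho>))"
proof -
  interpret E: Vector_Spaces.linear cscale cscale E by fact
  define S where "S = psd_sqrt \<rho>"
  define X where "X a' a = (\<chi> i j. S $ i $ a' * S $ a $ j)" for a' a
  \<comment> \<open>The transpose of \<open>M\<close> is the sum of the matrix units
    \<open>|a'><a|\<close> with weights \<open>M $ a $ a'\<close>, and \<open>X a' a\<close> is such
    a unit conjugated by \<open>S\<close>.\<close>
  have "S ** transpose M ** S = (\<Sum>a\<in>UNIV. \<Sum>a'\<in>UNIV. cscale (M $ a $ a') (X a' a))"
    by (simp add: vec_eq_iff matrix_matrix_mult_def transpose_def X_def cscale_def
        sum_distrib_left sum_distrib_right mult_ac)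
  then have "E (S ** transpose M ** S) = (\<Sum>a\<in>UNIV. \<Sum>a'\<in>UNIV. cscale (M $ a $ a') (E (X a' a)))"
    by (simp add: E.sum E.scale)
  then have "trace (N ** E (S ** transpose M ** S)) =
      (\<Sum>b\<in>UNIV. \<Sum>b'\<in>UNIV. \<Sum>a\<in>UNIV. \<Sum>a'\<in>UNIV.
        M $ a $ a' * N $ b $ b' * E (X a' a) $ b' $ b)"
    by (simp add: trace_def matrix_matrix_mult_def cscale_def sum_distrib_left mult_ac)
  \<comment> \<open>Three adjacent swaps take the summation order \<open>b, b', a, a'\<close> to
    \<open>a, b, a', b'\<close>, the order in which sums over pairs unfold.\<close>
  also have "\<dots> = (\<Sum>b\<in>UNIV. \<Sum>a\<in>UNIV. \<Sum>b'\<in>UNIV. \<Sum>a'\<in>UNIV.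
        M $ a $ a' * N $ b $ b' * E (X a' a) $ b' $ b)"
    by (intro sum.cong refl sum.swap)
  also have "\<dots> = (\<Sum>a\<in>UNIV. \<Sum>b\<in>UNIV. \<Sum>b'\<in>UNIV. \<Sum>a'\<in>UNIV.
        M $ a $ a' * N $ b $ b' * E (X a' a) $ b' $ b)"
    by (rule sum.swap)
  also have "\<dots> = (\<Sum>a\<in>UNIV. \<Sum>b\<in>UNIV. \<Sum>a'\<in>UNIV. \<Sum>b'\<in>UNIV.
        M $ a $ a' * N $ b $ b' * E (X a' a) $ b' $ b)"
    by (intro sum.cong refl sum.swap)
  also have "\<dots> = trace (kron M N ** isomorphic_state \<rho> E)"
    by (simp add: trace_def matrix_matrix_mult_def kron_def X_def S_def sum_UNIV_prod
        isomorphic_state_nth[OF \<rho>])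
  finally show ?thesis by (simp add: S_def)
qed

text \<open>By cyclicity of the trace, the probability of the outcome is the trace of the
  unnormalised prepared operator, and it cancels the normalisation whenever it is nonzero.\<close>

lemma sequential_prob_eq:
  assumes \<rho>: "psd \<rho>" and L: "psd L" and E: "Vector_Spaces.linear cscale cscale E"
  shows "sequential_prob L N \<rho> E = trace (N ** E (psd_sqrt \<rho> ** L ** psd_sqrt \<rho>))"
proof -
  interpret E: Vector_Spaces.linear cscale cscale E by fact
  let ?S = "psd_sqrt \<rho>"
  have "trace (?S ** L ** ?S) = trace (L ** (?S ** ?S))"
    by (metis matrix_mul_assoc trace_mul_sym)
  then have tr: "measurement_prob L \<rho> = trace (?S ** L ** ?S)"
    using psd_sqrt_square[OF \<rho>] by (simp add: measurement_prob_def)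
  show ?thesis
  proof (cases "measurement_prob L \<rho> = 0")
    case True
    \<comment> \<open>The left-hand side vanishes through its probability factor; this shows that
      the right-hand side vanishes too.\<close>
    then have "?S ** L ** ?S = 0"
      using tr psd_conjugate[OF psd_psd_sqrt[OF \<rho>] L] by (intro psd_trace_0) simp_all
    then show ?thesis using True by (simp add: sequential_prob_def E.zero trace_def)
  next
    case False
    have "trace (N ** cscale c Y) = c * trace (N ** Y)" for c Y
      by (simp add: trace_def matrix_matrix_mult_def cscale_def sum_distrib_left mult_ac)
    then show ?thesis using False
      by (simp add: sequential_prob_def prepared_state_def measurement_prob_def[of N] E.scale)
  qed
qed

theorem mainTheorem3:
  fixes \<rho> :: "complex^'a^'a"
    and E :: "complex^'a^'a \<Rightarrow> complex^'b^'b"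
    and M :: "nat \<Rightarrow> complex^'a^'a" and N :: "nat \<Rightarrow> complex^'b^'b"
    and I J :: "nat set"
  assumes "density_operator \<rho>"
    and "completely_positive E" and "trace_preserving E"
    and "povm I M" and "povm J N"
  shows "\<forall>m\<in>I. \<forall>n\<in>J.
      parallel_prob (M m) (N n) (isomorphic_state \<rho> E)
        = sequential_prob (transpose (M m)) (N n) \<rho> E \<and>
      trace (kron (M m) (N n) ** isomorphic_state \<rho> E)
        = trace (N n ** E (psd_sqrt \<rho> ** transpose (M m) ** psd_sqrt \<rho>))"
proof (intro ballI)
  fix m n
  assume "m \<in> I" "n \<in> J"
  have \<rho>: "psd \<rho>" using assms(1) by (simp add: density_operator_def)
  have E: "Vector_Spaces.linear cscale cscale E" using assms(2) by (simp add: completely_positive_def)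
  \<comment> \<open>Positivity of the transposed effect serves the zero-probability case of the
    preparation.\<close>
  have "psd (transpose (M m))" using assms(4) \<open>m \<in> I\<close> by (simp add: povm_def psd_transpose)
  then show "parallel_prob (M m) (N n) (isomorphic_state \<rho> E)
        = sequential_prob (transpose (M m)) (N n) \<rho> E \<and>
      trace (kron (M m) (N n) ** isomorphic_state \<rho> E)
        = trace (N n ** E (psd_sqrt \<rho> ** transpose (M m) ** psd_sqrt \<rho>))"
    by (simp add: parallel_prob_def measurement_prob_def trace_kron_isomorphic_state[OF \<rho> E]
        sequential_prob_eq[OF \<rho> _ E])
qed

end
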